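(* Let $q\ge1$, let $A=(a_1,\ldots,a_q)$, $B=(b_1,\ldots,b_q)$ be real vectors with $B\prec^W A$, and let $\sigma\ge1$. Then the function $z\mapsto{}_{q+1}F_q(\sigma,A;B;-z)$ maps the sector $0<\arg(z)<\pi/\sigma$ into the lower half-plane $\Im(z)<0$.
   Context: $B\prec^W A$ means: $0<a_1\le\cdots\le a_q$, $0<b_1\le\cdots\le b_q$, and $\sum_{i=1}^{k}a_i\le\sum_{i=1}^{k}b_i$ for $k=1,\ldots,q$. The generalized hypergeometric function is ${}_{q+1}F_q(\sigma,A;B;z)=\sum_{n=0}^{\infty}\frac{(\sigma)_n(a_1)_n\cdots(a_q)_n}{(b_1)_n\cdots(b_q)_n\,n!}z^n$ for $|z|<1$, extended by analytic continuation to $\mathbb{C}\setminus[1,\infty)$; $(a)_0=1$, $(a)_n=a(a+1)\cdots(a+n-1)$. *)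

theory Defs
  imports "HOL-Complex_Analysis.Complex_Analysis"
begin

text \<open>\<open>weak_supermaj B A\<close> is the relation \<open>B \<prec>\<^sup>W A\<close>. A vector is the list of its components, so
  the component with index \<open>i \<ge> 1\<close> is \<open>A ! (i - 1)\<close>.\<close>

definition weak_supermaj :: "real list \<Rightarrow> real list \<Rightarrow> bool" where
  "weak_supermaj B A \<longleftrightarrow>
     length B = length A \<and>
     (\<forall>a\<in>set A. 0 < a) \<and> sorted A \<and>
     (\<forall>b\<in>set B. 0 < b) \<and> sorted B \<and>
     (\<forall>k\<in>{1..length A}. (\<Sum>i<k. A ! i) \<le> (\<Sum>i<k. B ! i))"

definition slit_plane :: "complex set" where
  "slit_plane = - (complex_of_real ` {1..})"

text \<open>\<open>hypergeo as bs\<close> is meant for \<open>length as = length bs + 1\<close> and no entry of \<open>bs\<close> a nonpositive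
  integer. The series, whose coefficients \<open>fps_hypergeo as bs 1 $ n\<close> are
  \<open>(\<Prod>a. pochhammer a n) / ((\<Prod>b. pochhammer b n) * fact n)\<close>, then converges on the unit disc, and
  the choice picks its analytic continuation to the slit plane. By
  \<open>hypergeo_continuation_unique\<close> below, the choice is determined on the slit plane. The values on
  the cut \<open>[1, \<infinity>)\<close> are arbitrary.\<close>

definition hypergeo :: "complex list \<Rightarrow> complex list \<Rightarrow> complex \<Rightarrow> complex" where
  "hypergeo as bs =
     (SOME f. f holomorphic_on slit_plane \<and>
              (\<forall>z. norm z < 1 \<longrightarrow> f z = eval_fps (fps_hypergeo as bs 1) z))"

lemma open_slit_plane: "open slit_plane"
proof -
  have "closed (complex_of_real ` {1..})"
    by (intro closed_injective_linear_image) (auto simp: inj_on_def bounded_linear.linear bounded_linear_of_real)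
  then show ?thesis by (simp add: slit_plane_def open_Compl)
qed

lemma connected_slit_plane: "connected slit_plane"
proof (rule starlike_imp_connected)
  have *: "closed_segment 0 z \<subseteq> slit_plane" if "z \<in> slit_plane" for z
  proof
    fix w assume "w \<in> closed_segment 0 z"
    then obtain u where u: "0 \<le> u" "u \<le> 1" "w = of_real u * z"
      by (auto simp: in_segment scaleR_conv_of_real)
    show "w \<in> slit_plane"
    proof (rule ccontr)
      assume "w \<notin> slit_plane"
      then obtain x where x: "x \<ge> 1" "of_real u * z = of_real x"
        using u by (auto simp: slit_plane_def)
      then have "u \<noteq> 0" by auto
      then have "u > 0" using u by simp
      then have "z = of_real (x / u)" using x by (simp add: field_simps)
      moreover have "x / u \<ge> 1" using x u \<open>u > 0\<close> by (simp add: field_simps)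
      ultimately have "z \<in> complex_of_real ` {1..}" by (intro image_eqI) simp_all
      then show False using that by (simp add: slit_plane_def)
    qed
  qed
  have "(0::complex) \<in> slit_plane" by (auto simp: slit_plane_def)
  with * show "starlike slit_plane" unfolding starlike_def by blast
qed

lemma ball_subset_slit_plane: "ball 0 1 \<subseteq> slit_plane"
  by (auto simp: slit_plane_def)

lemma hypergeo_continuation_unique:
  assumes "f holomorphic_on slit_plane" "g holomorphic_on slit_plane"
    and "\<And>z. norm z < 1 \<Longrightarrow> f z = g z" and "z \<in> slit_plane"
  shows "f z = g z"
  using analytic_continuation_open[of "ball 0 1" slit_plane f g z]
    open_slit_plane connected_slit_plane ball_subset_slit_plane assms by auto

end

theory Submission
  imports Defs
begin

text \<open>Put \<open>m\<^sub>n = \<Prod>\<^sub>i (a\<^sub>i)\<^sub>n / (b\<^sub>i)\<^sub>n\<close>. If \<open>m\<close> is the moment sequence of a measure \<open>\<mu>\<close> on \<open>[0, 1]\<close>, then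
  \<open>F(-z) = \<integral> (1 + t z) powr -\<sigma> d\<mu>(t)\<close>, and each integrand maps the sector into the closed lower
  half-plane because \<open>Arg (1 + t z) \<le> Arg z\<close>. By Hausdorff's theorem it suffices that \<open>m\<close> is completely
  monotone. The ratio \<open>m\<^sub>n / m\<^sub>n\<^sub>+\<^sub>1\<close> is \<open>u\<^sub>n = \<Prod>\<^sub>i (b\<^sub>i + n) / (a\<^sub>i + n)\<close>. With
  \<open>\<Delta> f x = f x - f (x + 1)\<close>, majorization applied to \<open>\<Delta>\<^sup>k ln\<close> shows that \<open>ln u\<^sub>n\<close> is completely monotone, hence so are \<open>u\<close> and its products; finally
  \<open>m\<^sub>n = lim\<^sub>N m\<^sub>N \<cdot> (u\<^sub>n \<cdots> u\<^sub>n\<^sub>+\<^sub>N\<^sub>-\<^sub>1)\<close>, since \<open>u\<^sub>n \<longlonglongrightarrow> 1\<close>.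

  The measure itself is avoided: the integrals against Hausdorff's discrete measures, with mass
  \<open>C(N, k) (\<Delta>\<^sup>N\<^sup>-\<^sup>k m)\<^sub>k\<close> at \<open>k / N\<close>, form a normal family on the slit plane, and their coefficients at
  \<open>0\<close> tend to those of \<open>F\<close>. So Montel's theorem yields the analytic continuation together with
  \<open>Im F(-z) \<le> 0\<close>, and the open mapping theorem makes the inequality strict.\<close>

subsection \<open>Completely monotone sequences\<close>

text \<open>The domain type is generic because the operator acts both on sequences over
  \<open>nat\<close> and on \<open>ln\<close> over \<open>real\<close>;
  \<open>diff_op_power_shift\<close> passes between them. As the negative of the forward difference
  it avoids the signs \<open>(-1) ^ k\<close>.\<close>

definition diff_op :: "('a::semiring_1 \<Rightarrow> real) \<Rightarrow> 'a \<Rightarrow> real" where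
  "diff_op f = (\<lambda>x. f x - f (x + 1))"

definition completely_monotone :: "(nat \<Rightarrow> real) \<Rightarrow> bool" where
  "completely_monotone f \<longleftrightarrow> (\<forall>k n. 0 \<le> (diff_op ^^ k) f n)"

lemma diff_op_power_Suc: "(diff_op ^^ Suc k) f x = (diff_op ^^ k) f x - (diff_op ^^ k) f (x + 1)"
  by (simp add: diff_op_def)

lemma diff_op_power_0: "(diff_op ^^ k) (\<lambda>x. 0) x = 0"
  by (induction k arbitrary: x) (simp_all add: diff_op_power_Suc del: funpow.simps(2))

lemma diff_op_power_add:
  "(diff_op ^^ k) (\<lambda>x. f x + g x) x = (diff_op ^^ k) f x + (diff_op ^^ k) g x"
  by (induction k arbitrary: x) (simp_all add: diff_op_power_Suc del: funpow.simps(2))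

lemma diff_op_power_diff:
  "(diff_op ^^ k) (\<lambda>x. f x - g x) x = (diff_op ^^ k) f x - (diff_op ^^ k) g x"
  by (induction k arbitrary: x) (simp_all add: diff_op_power_Suc del: funpow.simps(2))

lemma diff_op_power_sum:
  "(diff_op ^^ k) (\<lambda>x. \<Sum>i\<in>I. f i x) x = (\<Sum>i\<in>I. (diff_op ^^ k) (f i) x)"
  by (induction k arbitrary: x)
    (simp_all add: diff_op_power_Suc sum_subtractf del: funpow.simps(2))

lemma diff_op_power_cmult: "(diff_op ^^ k) (\<lambda>x. c * f x) x = c * (diff_op ^^ k) f x"
  by (induction k arbitrary: x)
    (simp_all add: diff_op_power_Suc right_diff_distrib del: funpow.simps(2))

lemma diff_op_power_shift:
  "(diff_op ^^ k) (\<lambda>n. f (x + of_nat n)) n = (diff_op ^^ k) f (x + of_nat n)"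
  for f :: "'a::semiring_1 \<Rightarrow> real"
  by (induction k arbitrary: n)
    (simp_all add: diff_op_power_Suc add.assoc add.commute[of 1] del: funpow.simps(2))

lemma diff_op_power_tendsto:
  assumes "\<And>x. ((\<lambda>N. f N x) \<longlongrightarrow> g x) F"
  shows "((\<lambda>N. (diff_op ^^ k) (f N) x) \<longlongrightarrow> (diff_op ^^ k) g x) F"
  by (induction k arbitrary: x)
    (auto simp: diff_op_power_Suc assms simp del: funpow.simps(2) intro!: tendsto_diff)

lemma completely_monotone_nonneg: "completely_monotone f \<Longrightarrow> 0 \<le> f n"
  unfolding completely_monotone_def by (metis funpow_0)

lemma completely_monotone_diff_op: "completely_monotone f \<Longrightarrow> completely_monotone (diff_op f)"
  unfolding completely_monotone_def by (metis funpow_Suc_right comp_apply)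

lemma completely_monotone_shift:
  "completely_monotone f \<Longrightarrow> completely_monotone (\<lambda>n. f (m + n))"
  using diff_op_power_shift[where 'a = nat and f = f] by (simp add: completely_monotone_def)

lemma completely_monotone_const: "0 \<le> c \<Longrightarrow> completely_monotone (\<lambda>_. c)"
  unfolding completely_monotone_def
proof (intro allI)
  fix k n assume "0 \<le> c" then show "0 \<le> (diff_op ^^ k) (\<lambda>_. c) (n::nat)"
    by (cases k) (simp_all add: diff_op_power_0 funpow_swap1 diff_op_def[of "\<lambda>_. c"])
qed

lemma completely_monotone_sum:
  "(\<And>i. i \<in> I \<Longrightarrow> completely_monotone (f i)) \<Longrightarrow> completely_monotone (\<lambda>n. \<Sum>i\<in>I. f i n)"
  by (simp add: completely_monotone_def diff_op_power_sum sum_nonneg)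

lemma completely_monotone_cmult:
  "0 \<le> c \<Longrightarrow> completely_monotone f \<Longrightarrow> completely_monotone (\<lambda>n. c * f n)"
  by (simp add: completely_monotone_def diff_op_power_cmult)

text \<open>By a discrete Leibniz rule the difference of a product is a sum of two products of
  completely monotone sequences, so induction on the order runs over all pairs at once.\<close>

lemma completely_monotone_mult:
  assumes "completely_monotone f" "completely_monotone g"
  shows "completely_monotone (\<lambda>n. f n * g n)"
proof -
  have "0 \<le> (diff_op ^^ k) (\<lambda>n. f n * g n) n"
    if "completely_monotone f" "completely_monotone g" for k n f g
    using that
  proof (induction k arbitrary: f g n)
    case 0
    then show ?case by (simp add: completely_monotone_nonneg)
  next
    case (Suc k)
    have leibniz: "diff_op (\<lambda>n. f n * g n) = (\<lambda>n. diff_op f n * g n + f (1 + n) * diff_op g n)"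
      by (simp add: diff_op_def fun_eq_iff algebra_simps)
    show ?case
      unfolding funpow_Suc_right comp_apply leibniz diff_op_power_add
      using Suc.IH[OF completely_monotone_diff_op[OF Suc.prems(1)] Suc.prems(2)]
        Suc.IH[OF completely_monotone_shift[OF Suc.prems(1)] completely_monotone_diff_op[OF Suc.prems(2)]]
      by (rule add_nonneg_nonneg)
  qed
  with assms show ?thesis by (simp add: completely_monotone_def)
qed

lemma completely_monotone_prod:
  assumes "\<And>i. i \<in> I \<Longrightarrow> completely_monotone (f i)"
  shows "completely_monotone (\<lambda>n. \<Prod>i\<in>I. f i n)"
  using assms
  by (induction I rule: infinite_finite_induct)
    (auto intro: completely_monotone_const completely_monotone_mult)

lemma completely_monotone_limit:
  assumes "\<And>N. completely_monotone (f N)" "\<And>n. (\<lambda>N. f N n) \<longlonglongrightarrow> g n"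
  shows "completely_monotone g"
  unfolding completely_monotone_def
proof (intro allI)
  fix k n
  show "0 \<le> (diff_op ^^ k) g n"
    using assms(1)
    by (intro tendsto_lowerbound[OF diff_op_power_tendsto[of f g, OF assms(2)]])
      (auto simp: completely_monotone_def)
qed

text \<open>The exponential series has nonnegative coefficients, so its partial sums stay completely
  monotone, and pointwise limits preserve this.\<close>

lemma completely_monotone_exp:
  assumes "completely_monotone f"
  shows "completely_monotone (\<lambda>n. exp (f n))"
proof (rule completely_monotone_limit)
  \<comment> \<open>The power \<open>f n ^ j\<close> is written as a product over
    \<open>i < j\<close> so that closure under finite products applies.\<close>
  show "completely_monotone (\<lambda>n. \<Sum>j<J. inverse (fact j) * (\<Prod>i<j. f n))" for J
    using assms
    by (intro completely_monotone_sum completely_monotone_cmult completely_monotone_prod) auto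
  show "(\<lambda>J. \<Sum>j<J. inverse (fact j) * (\<Prod>i<j. f n)) \<longlonglongrightarrow> exp (f n)" for n
    using exp_converges[of "f n"] by (simp add: sums_def)
qed

section \<open>Iterated differences of the logarithm under weak majorization\<close>

lemma has_real_derivative_diff_op_power_ln:
  assumes "0 < (x::real)"
  shows "((diff_op ^^ k) ln has_real_derivative fact k / pochhammer x (Suc k)) (at x)"
  using assms
proof (induction k arbitrary: x)
  case 0
  then show ?case by (auto intro!: derivative_eq_intros simp: field_simps)
next
  case (Suc k)
  have p: "pochhammer (x + 1) k > 0" using Suc.prems by (simp add: pochhammer_pos)
  have "((\<lambda>y. (diff_op ^^ k) ln (y + 1)) has_real_derivative fact k / pochhammer (x + 1) (Suc k)) (at x)"
    using Suc.prems by (intro iffD1[OF DERIV_shift] Suc.IH) simp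
  then have "((\<lambda>x. (diff_op ^^ k) ln x - (diff_op ^^ k) ln (x + 1)) has_real_derivative
      fact k / pochhammer x (Suc k) - fact k / pochhammer (x + 1) (Suc k)) (at x)"
    using Suc.IH[of x] Suc.prems by (intro DERIV_diff) auto
  also have "pochhammer x (Suc k) = x * pochhammer (x + 1) k"
    by (rule pochhammer_rec)
  also have "pochhammer (x + 1) (Suc k) = pochhammer (x + 1) k * (x + 1 + real k)"
    by (rule pochhammer_Suc)
  \<comment> \<open>The partial fractions \<open>1 / x - 1 / (x + 1 + k)\<close> have numerator
    \<open>k + 1\<close>, which turns \<open>fact k\<close> into
    \<open>fact (Suc k)\<close>.\<close>
  also have "fact k / (x * pochhammer (x + 1) k) - fact k / (pochhammer (x + 1) k * (x + 1 + real k))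
      = fact (Suc k) / (x * (pochhammer (x + 1) k * (x + 1 + real k)))"
    using Suc.prems p by (simp add: divide_simps) (simp add: algebra_simps)
  also have "x * (pochhammer (x + 1) k * (x + 1 + real k)) = pochhammer x (Suc (Suc k))"
    by (simp only: pochhammer_rec[of x "Suc k"] pochhammer_Suc[of "x + 1" k])
  finally show ?case by (simp only: funpow.simps comp_apply diff_op_def[of "(diff_op ^^ k) ln"])
qed

lemma pochhammer_mono:
  fixes x y :: real
  assumes "0 < x" "x \<le> y"
  shows "pochhammer x n \<le> pochhammer y n"
  using assms by (induction n) (auto simp: pochhammer_Suc less_imp_le intro!: mult_mono pochhammer_nonneg)

text \<open>Abel summation as an induction: since partial sums of \<open>d\<close> are nonnegative,
  replacing the earlier weights by the newest, smaller one can only lower the sum.\<close>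

lemma sum_mult_nonneg_of_partial_sums:
  fixes c d :: "nat \<Rightarrow> real"
  assumes "\<And>i. i < q \<Longrightarrow> 0 \<le> c i" "\<And>i. Suc i < q \<Longrightarrow> c (Suc i) \<le> c i"
    and "\<And>k. k \<le> q \<Longrightarrow> 0 \<le> (\<Sum>i<k. d i)"
  shows "0 \<le> (\<Sum>i<q. c i * d i)"
proof (cases q)
  case (Suc p)
  have "c k * (\<Sum>i<Suc k. d i) \<le> (\<Sum>i<Suc k. c i * d i)" if "k < q" for k
    using that
  proof (induction k)
    case (Suc k)
    have "c (Suc k) * (\<Sum>i<Suc (Suc k). d i) = c (Suc k) * (\<Sum>i<Suc k. d i) + c (Suc k) * d (Suc k)"
      by (simp add: distrib_left)
    also have "\<dots> \<le> c k * (\<Sum>i<Suc k. d i) + c (Suc k) * d (Suc k)"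
      using assms(2)[OF Suc.prems] assms(3)[of "Suc k"] Suc.prems
      by (intro add_mono mult_right_mono order.refl) simp_all
    also have "\<dots> \<le> (\<Sum>i<Suc (Suc k). c i * d i)"
      using Suc.IH Suc.prems by simp
    finally show ?case .
  qed simp
  from this[of p] have "c p * (\<Sum>i<q. d i) \<le> (\<Sum>i<q. c i * d i)"
    by (simp only: Suc lessI simp_thms)
  moreover have "0 \<le> c p * (\<Sum>i<q. d i)"
    using assms(1)[of p] assms(3)[of q] Suc by (intro mult_nonneg_nonneg) simp_all
  ultimately show ?thesis by linarith
qed simp

text \<open>This is the Tomic-Weyl inequality for \<open>\<Delta>\<^sup>k ln\<close>, which is concave and
  increasing because its derivative is \<open>k! / (x)\<^sub>k\<^sub>+\<^sub>1\<close>.\<close>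

lemma sum_diff_op_power_ln_le:
  fixes a b :: "nat \<Rightarrow> real"
  assumes a: "\<And>i. i < q \<Longrightarrow> 0 < a i" and b: "\<And>i. i < q \<Longrightarrow> 0 < b i"
    and mono: "\<And>i. Suc i < q \<Longrightarrow> b i \<le> b (Suc i)"
    and maj: "\<And>k. k \<le> q \<Longrightarrow> (\<Sum>i<k. a i) \<le> (\<Sum>i<k. b i)" and "0 \<le> t"
  shows "(\<Sum>i<q. (diff_op ^^ k) ln (a i + t)) \<le> (\<Sum>i<q. (diff_op ^^ k) ln (b i + t))"
proof -
  let ?g = "(diff_op ^^ k) ln :: real \<Rightarrow> real"
  define c where "c x = fact k / pochhammer x (Suc k)" for x :: real
  have pos: "0 < c x" if "0 < x" for x
    using that by (simp add: c_def pochhammer_pos del: pochhammer_Suc)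
  have anti: "c y \<le> c x" if "0 < x" "x \<le> y" for x y
    unfolding c_def using that
    by (intro divide_left_mono pochhammer_mono mult_pos_pos pochhammer_pos) auto
  have deriv: "(?g has_real_derivative c x) (at x)" if "0 < x" for x
    unfolding c_def using that by (rule has_real_derivative_diff_op_power_ln)
  \<comment> \<open>By the mean value theorem and monotonicity of \<open>c\<close>, the graph of
    \<open>?g\<close> lies below its tangent at \<open>y\<close>. Taking \<open>y = b i + t\<close>
    gives weights that do not increase with \<open>i\<close>, as Abel summation requires.\<close>
  have tangent: "c y * (y - x) \<le> ?g y - ?g x" if xy: "0 < x" "0 < y" for x y
  proof (cases x y rule: linorder_cases)
    case less
    then obtain z where "x < z" "z < y" "?g y - ?g x = (y - x) * c z"
      using MVT2[of x y ?g c] deriv xy by force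
    then show ?thesis using anti[of z y] xy less by (simp add: mult.commute mult_left_mono)
  next
    case greater
    then obtain z where z: "y < z" "z < x" "?g x - ?g y = (x - y) * c z"
      using MVT2[of y x ?g c] deriv xy by force
    then have "(x - y) * c z \<le> (x - y) * c y" using anti[of y z] xy greater by (intro mult_left_mono) auto
    with z show ?thesis by (simp add: algebra_simps)
  qed simp
  have "0 \<le> (\<Sum>i<q. c (b i + t) * (b i - a i))"
  proof (rule sum_mult_nonneg_of_partial_sums)
    show "0 \<le> c (b i + t)" if "i < q" for i using pos b[OF that] \<open>0 \<le> t\<close> by (simp add: less_imp_le)
    show "c (b (Suc i) + t) \<le> c (b i + t)" if "Suc i < q" for i
      using anti mono[OF that] b[of i] that \<open>0 \<le> t\<close> by simp
  qed (use maj in \<open>simp add: sum_subtractf\<close>)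
  also have "\<dots> \<le> (\<Sum>i<q. ?g (b i + t) - ?g (a i + t))"
    using tangent[of "a i + t" "b i + t" for i] a b \<open>0 \<le> t\<close> by (intro sum_mono) (simp add: add_pos_nonneg)
  finally show ?thesis by (simp add: sum_subtractf)
qed

section \<open>Ratios of Pochhammer products\<close>

definition poch_ratio :: "nat \<Rightarrow> (nat \<Rightarrow> real) \<Rightarrow> (nat \<Rightarrow> real) \<Rightarrow> nat \<Rightarrow> real" where
  "poch_ratio q a b n = (\<Prod>i<q. pochhammer (a i) n / pochhammer (b i) n)"

lemma completely_monotone_step_ratio:
  fixes a b :: "nat \<Rightarrow> real"
  assumes a: "\<And>i. i < q \<Longrightarrow> 0 < a i" and b: "\<And>i. i < q \<Longrightarrow> 0 < b i"
    and mono: "\<And>i. Suc i < q \<Longrightarrow> b i \<le> b (Suc i)"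
    and maj: "\<And>k. k \<le> q \<Longrightarrow> (\<Sum>i<k. a i) \<le> (\<Sum>i<k. b i)"
  shows "completely_monotone (\<lambda>n. \<Prod>i<q. (b i + real n) / (a i + real n))"
proof -
  \<comment> \<open>By linearity, the difference of order \<open>k\<close> at \<open>n\<close> is
    the gap between the two sums in \<open>sum_diff_op_power_ln_le\<close> for
    \<open>t = real n\<close>.\<close>
  have "completely_monotone (\<lambda>n. \<Sum>i<q. ln (b i + real n) - ln (a i + real n))"
    unfolding completely_monotone_def diff_op_power_sum diff_op_power_diff
      diff_op_power_shift[where 'a = real and f = ln]
    using sum_diff_op_power_ln_le[OF assms] by (simp add: sum_subtractf)
  then have "completely_monotone (\<lambda>n. exp (\<Sum>i<q. ln (b i + real n) - ln (a i + real n)))"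
    by (rule completely_monotone_exp)
  also have "(\<lambda>n. exp (\<Sum>i<q. ln (b i + real n) - ln (a i + real n)))
      = (\<lambda>n. \<Prod>i<q. (b i + real n) / (a i + real n))"
    using a b by (auto simp: fun_eq_iff exp_sum exp_diff add_pos_nonneg intro!: prod.cong)
  finally show ?thesis .
qed

lemma completely_monotone_poch_ratio:
  fixes a b :: "nat \<Rightarrow> real"
  assumes a: "\<And>i. i < q \<Longrightarrow> 0 < a i" and b: "\<And>i. i < q \<Longrightarrow> 0 < b i"
    and mono: "\<And>i. Suc i < q \<Longrightarrow> b i \<le> b (Suc i)"
    and maj: "\<And>k. k \<le> q \<Longrightarrow> (\<Sum>i<k. a i) \<le> (\<Sum>i<k. b i)"
  shows "completely_monotone (poch_ratio q a b)"
proof (rule completely_monotone_limit)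
  define u where "u n = (\<Prod>i<q. (b i + real n) / (a i + real n))" for n
  let ?m = "poch_ratio q a b"
  have m_pos: "0 < ?m n" for n
    using a b by (auto simp: poch_ratio_def intro!: prod_pos divide_pos_pos pochhammer_pos)
  have u_pos: "0 < u n" for n
    using a b by (auto simp: u_def intro!: prod_pos divide_pos_pos add_pos_nonneg)
  have m_Suc: "?m (Suc n) * u n = ?m n" for n
    unfolding poch_ratio_def u_def prod.distrib[symmetric]
  proof (rule prod.cong)
    fix i assume "i \<in> {..<q}"
    then have "a i + real n > 0" "b i + real n > 0"
      using a b by (auto intro: add_pos_nonneg)
    then show "pochhammer (a i) (Suc n) / pochhammer (b i) (Suc n) * ((b i + real n) / (a i + real n)) =
        pochhammer (a i) n / pochhammer (b i) n"
      by (simp add: pochhammer_Suc)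
  qed simp
  have shift: "?m (n + N) * (\<Prod>k<N. u (n + k)) = ?m n" for n N
  proof (induction N)
    case (Suc N)
    have "?m (n + Suc N) * (\<Prod>k<Suc N. u (n + k)) = ?m (Suc (n + N)) * u (n + N) * (\<Prod>k<N. u (n + k))"
      by simp
    then show ?case by (simp only: m_Suc Suc.IH)
  qed simp
  have u_lim: "u \<longlonglongrightarrow> 1"
  proof -
    have "(\<lambda>n. (b i + real n) / (a i + real n)) \<longlonglongrightarrow> 1" for i by real_asymp
    then have "(\<lambda>n. \<Prod>i<q. (b i + real n) / (a i + real n)) \<longlonglongrightarrow> (\<Prod>i<q. 1)" by (intro tendsto_prod)
    then show ?thesis by (simp add: u_def[abs_def])
  qed
  show "completely_monotone (\<lambda>n. ?m N * (\<Prod>k<N. u (k + n)))" for N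
  proof (intro completely_monotone_cmult completely_monotone_prod)
    show "completely_monotone (\<lambda>n. u (k + n))" for k
      unfolding u_def[abs_def] by (rule completely_monotone_shift[OF completely_monotone_step_ratio[OF assms]])
  qed (simp add: m_pos less_imp_le)
  show "(\<lambda>N. ?m N * (\<Prod>k<N. u (k + n))) \<longlonglongrightarrow> ?m n" for n
  proof -
    \<comment> \<open>Reaching \<open>?m (n + N)\<close> from \<open>n\<close> in \<open>N\<close>
      steps or from \<open>N\<close> in \<open>n\<close> steps trades the growing product for one
      with \<open>n\<close> factors, each tending to 1.\<close>
    have "?m N * (\<Prod>k<N. u (k + n)) = ?m n * (\<Prod>k<n. u (k + N))" for N
    proof -
      have "?m (n + N) * (?m N * (\<Prod>k<N. u (k + n))) = ?m (n + N) * (?m n * (\<Prod>k<n. u (k + N)))"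
        using shift[of n N] shift[of N n] by (simp add: add.commute mult_ac)
      then show ?thesis using m_pos[of "n + N"] by simp
    qed
    moreover have "(\<lambda>N. ?m n * (\<Prod>k<n. u (k + N))) \<longlonglongrightarrow> ?m n * (\<Prod>k<n. 1)"
      using LIMSEQ_ignore_initial_segment[OF u_lim]
      by (intro tendsto_mult tendsto_const tendsto_prod) (simp add: add.commute)
    ultimately show ?thesis by simp
  qed
qed

subsection \<open>Hausdorff moments and generalized Stieltjes transforms\<close>

text \<open>With \<open>S\<close> the shift, \<open>diff_op\<close> is \<open>I - S\<close>; this is
  the binomial expansion of \<open>(diff_op + S) ^ M = I\<close>.\<close>

lemma sum_binomial_diff_op_power:
  "(\<Sum>j\<le>M. real (M choose j) * (diff_op ^^ (M - j)) m (n + j)) = m n" for m :: "nat \<Rightarrow> real"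
proof (induction M arbitrary: m n)
  case (Suc M)
  define d where "d j i = (diff_op ^^ j) m i" for j i
  have "(\<Sum>j\<le>Suc M. real (Suc M choose j) * d (Suc M - j) (n + j))
      = d (Suc M) n + (\<Sum>j\<le>M. real (Suc M choose Suc j) * d (M - j) (n + Suc j))"
    by (subst sum.atMost_Suc_shift) simp
  \<comment> \<open>Pascal's rule splits the sum into the induction hypotheses for
    \<open>diff_op m\<close> at \<open>n\<close> and for \<open>m\<close> at
    \<open>Suc n\<close>.\<close>
  also have "\<dots> = d (Suc M) n + (\<Sum>j\<le>M. real (M choose Suc j) * d (M - j) (n + Suc j))
      + (\<Sum>j\<le>M. real (M choose j) * d (M - j) (n + Suc j))"
    by (simp add: distrib_right sum.distrib)
  also have "d (Suc M) n + (\<Sum>j\<le>M. real (M choose Suc j) * d (M - j) (n + Suc j))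
      = (\<Sum>j\<le>Suc M. real (M choose j) * d (Suc M - j) (n + j))"
    by (subst sum.atMost_Suc_shift) simp
  also have "\<dots> = (\<Sum>j\<le>M. real (M choose j) * (diff_op ^^ (M - j)) (diff_op m) (n + j))"
    by (auto simp: d_def Suc_diff_le funpow_Suc_right simp del: funpow.simps(2) intro!: sum.cong)
  also have "\<dots> = diff_op m n"
    by (rule Suc.IH)
  also have "(\<Sum>j\<le>M. real (M choose j) * d (M - j) (n + Suc j)) = m (Suc n)"
    using Suc.IH[of m "Suc n"] by (simp add: d_def)
  finally show ?case
    by (simp add: d_def diff_op_def[of m])
qed simp

text \<open>If \<open>m\<close> has a representing measure on \<open>[0, 1]\<close>, this is the
  integral of the Bernstein polynomial \<open>C(N, k) t^k (1 - t)^(N - k)\<close>.\<close>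

definition hausdorff_weight :: "(nat \<Rightarrow> real) \<Rightarrow> nat \<Rightarrow> nat \<Rightarrow> real" where
  "hausdorff_weight m N k = real (N choose k) * (diff_op ^^ (N - k)) m k"

lemma hausdorff_weight_nonneg: "completely_monotone m \<Longrightarrow> 0 \<le> hausdorff_weight m N k"
  by (simp add: hausdorff_weight_def completely_monotone_def)

lemma sum_hausdorff_weight: "(\<Sum>k\<le>N. hausdorff_weight m N k) = m 0"
  using sum_binomial_diff_op_power[of N m 0] by (simp add: hausdorff_weight_def)

text \<open>The moments are exact when \<open>(k / N) ^ n\<close> is replaced by a ratio of
  binomials: absorbing \<open>N choose k\<close> into \<open>N - n choose (k - n)\<close> leaves the
  previous identity of order \<open>N - n\<close>.\<close>

lemma sum_hausdorff_weight_binomial: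
  assumes "n \<le> N"
  shows "(\<Sum>k\<le>N. hausdorff_weight m N k * (real (k choose n) / real (N choose n))) = m n"
proof -
  have "(\<Sum>k\<le>N. hausdorff_weight m N k * (real (k choose n) / real (N choose n)))
      = (\<Sum>k\<in>{n..N}. hausdorff_weight m N k * (real (k choose n) / real (N choose n)))"
    by (rule sum.mono_neutral_right) (auto simp: binomial_eq_0)
  also have "\<dots> = (\<Sum>k\<in>{n..N}. real (N - n choose (k - n)) * (diff_op ^^ (N - k)) m k)"
  proof (rule sum.cong)
    fix k assume k: "k \<in> {n..N}"
    then have "real (N choose k) * real (k choose n) = real (N choose n) * real (N - n choose (k - n))"
      using choose_mult[of n k N] by (simp flip: of_nat_mult)
    moreover have "real (N choose n) \<noteq> 0" using assms by simp
    ultimately show "hausdorff_weight m N k * (real (k choose n) / real (N choose n)) =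
        real (N - n choose (k - n)) * (diff_op ^^ (N - k)) m k"
      by (simp add: hausdorff_weight_def field_simps)
  qed simp
  also have "\<dots> = (\<Sum>j\<le>N - n. real (N - n choose j) * (diff_op ^^ (N - n - j)) m (n + j))"
    using assms
    by (intro sum.reindex_bij_witness[of _ "\<lambda>j. n + j" "\<lambda>k. k - n"]) auto
  also have "\<dots> = m n" by (rule sum_binomial_diff_op_power)
  finally show ?thesis .
qed

lemma binomial_ratio_approx:
  assumes "2 * n \<le> N" "0 < N" "k \<le> N"
  shows "\<bar>real (k choose n) / real (N choose n) - (real k / real N) ^ n\<bar> \<le> real n * (real n / (real N - real n))"
proof -
  \<comment> \<open>This also covers \<open>k < n\<close>, where the factor with
    \<open>j = k\<close> vanishes.\<close>
  have ratio: "real (k choose n) / real (N choose n) = (\<Prod>j<n. (real k - real j) / (real N - real j))"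
    by (simp add: binomial_gbinomial gbinomial_prod_rev prod_dividef atLeast0LessThan)
  \<comment> \<open>Products of numbers of modulus at most 1 differ by at most the sum of the
    differences of their factors; \<open>2 * n \<le> N\<close> keeps the factors with
    \<open>j > k\<close> above \<open>-1\<close>.\<close>
  have "\<bar>(\<Prod>j<n. (real k - real j) / (real N - real j)) - (\<Prod>j<n. real k / real N)\<bar>
      \<le> (\<Sum>j<n. \<bar>(real k - real j) / (real N - real j) - real k / real N\<bar>)"
    using assms by (intro norm_prod_diff[where 'a = real, unfolded real_norm_def]) (auto simp: abs_le_iff field_simps)
  also have "\<dots> \<le> (\<Sum>j<n. real n / (real N - real n))"
  proof (rule sum_mono)
    fix j assume "j \<in> {..<n}"
    then have j: "real j \<le> real n" "real n < real N" using assms by auto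
    have "(real k - real j) / (real N - real j) - real k / real N =
        - (real j * ((real N - real k) / real N) / (real N - real j))"
      using j by (simp add: divide_simps) (simp add: algebra_simps)
    then have "\<bar>(real k - real j) / (real N - real j) - real k / real N\<bar>
        = real j * ((real N - real k) / real N) / (real N - real j)"
      using j assms by (simp add: abs_mult)
    also have "\<dots> \<le> real n / (real N - real n)"
    proof (rule frac_le)
      have "real j * ((real N - real k) / real N) \<le> real n * 1"
        using j assms by (intro mult_mono) auto
      then show "real j * ((real N - real k) / real N) \<le> real n" by simp
    qed (use j in auto)
    finally show "\<bar>(real k - real j) / (real N - real j) - real k / real N\<bar> \<le> real n / (real N - real n)" .
  qed
  finally show ?thesis by (simp add: ratio)
qed

text \<open>The weights are nonnegative with total mass \<open>m 0\<close>, so the uniform error of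
  the binomial ratio, which vanishes as \<open>N\<close> grows, bounds the error of the
  moment.\<close>

lemma hausdorff_moments_tendsto:
  assumes m: "completely_monotone m"
  shows "(\<lambda>N. \<Sum>k\<le>N. hausdorff_weight m N k * (real k / real N) ^ n) \<longlonglongrightarrow> m n"
proof (rule LIM_zero_cancel, rule Lim_null_comparison)
  show "\<forall>\<^sub>F N in sequentially. norm ((\<Sum>k\<le>N. hausdorff_weight m N k * (real k / real N) ^ n) - m n)
      \<le> m 0 * (real n * (real n / (real N - real n)))"
    using eventually_ge_at_top[of "2 * n + 1"]
  proof eventually_elim
    case (elim N)
    have "(\<Sum>k\<le>N. hausdorff_weight m N k * (real k / real N) ^ n) - m n
        = (\<Sum>k\<le>N. hausdorff_weight m N k * ((real k / real N) ^ n - real (k choose n) / real (N choose n)))"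
      using sum_hausdorff_weight_binomial[of n N m] elim by (simp add: right_diff_distrib sum_subtractf)
    also have "norm \<dots> \<le> (\<Sum>k\<le>N. hausdorff_weight m N k * (real n * (real n / (real N - real n))))"
    proof (intro order.trans[OF norm_sum] sum_mono)
      fix k assume "k \<in> {..N}"
      then have "\<bar>(real k / real N) ^ n - real (k choose n) / real (N choose n)\<bar>
          \<le> real n * (real n / (real N - real n))"
        using binomial_ratio_approx[of n N k] elim by (subst abs_minus_commute) simp
      then show "norm (hausdorff_weight m N k * ((real k / real N) ^ n - real (k choose n) / real (N choose n)))
          \<le> hausdorff_weight m N k * (real n * (real n / (real N - real n)))"
        unfolding real_norm_def abs_mult abs_of_nonneg[OF hausdorff_weight_nonneg[OF m]]
        by (rule mult_left_mono) (rule hausdorff_weight_nonneg[OF m])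
    qed
    also have "\<dots> = m 0 * (real n * (real n / (real N - real n)))"
      by (simp only: sum_hausdorff_weight flip: sum_distrib_right)
    finally show ?case .
  qed
  show "(\<lambda>N. m 0 * (real n * (real n / (real N - real n)))) \<longlonglongrightarrow> 0"
    by real_asymp
qed

section \<open>The kernel \<open>(1 - t z) powr -\<sigma>\<close> and its discrete averages\<close>

lemma kernel_argument_not_nonpos:
  assumes "z \<in> slit_plane" "0 \<le> t" "t \<le> 1"
  shows "1 - complex_of_real t * z \<notin> \<real>\<^sub>\<le>\<^sub>0"
proof
  assume "1 - complex_of_real t * z \<in> \<real>\<^sub>\<le>\<^sub>0"
  then obtain x where x: "x \<le> 0" "1 - complex_of_real t * z = complex_of_real x"
    by (auto elim: nonpos_Reals_cases)
  then have eq: "complex_of_real t * z = complex_of_real (1 - x)" by (simp add: algebra_simps)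
  with x have "t \<noteq> 0" by auto
  with eq have "z = complex_of_real ((1 - x) / t)" by (simp add: field_simps)
  moreover have "(1 - x) / t \<ge> 1" using assms x \<open>t \<noteq> 0\<close> by (simp add: field_simps)
  ultimately have "z \<in> complex_of_real ` {1..}" by blast
  then show False using assms(1) by (simp add: slit_plane_def)
qed

lemma kernel_sums:
  fixes \<sigma> :: real
  assumes "norm z < 1"
  shows "(\<lambda>n. complex_of_real (pochhammer \<sigma> n / fact n) * z ^ n) sums ((1 - z) powr (- complex_of_real \<sigma>))"
proof -
  have "(\<lambda>n. ((- complex_of_real \<sigma>) gchoose n) * (- z) ^ n) sums ((1 + - z) powr (- complex_of_real \<sigma>))"
    using assms by (intro gen_binomial_complex) simp
  moreover have "((- complex_of_real \<sigma>) gchoose n) * (- z) ^ n = complex_of_real (pochhammer \<sigma> n / fact n) * z ^ n" for n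
  proof -
    \<comment> \<open>One sign comes from the binomial coefficient with negative upper entry, the
      other from \<open>(- z) ^ n\<close>; they cancel.\<close>
    have "((- complex_of_real \<sigma>) gchoose n) * (- z) ^ n =
        ((- 1) ^ n * (- 1) ^ n) * (complex_of_real (pochhammer \<sigma> n / fact n) * z ^ n)"
      by (simp add: gbinomial_pochhammer pochhammer_of_real power_minus[of z])
    then show ?thesis by (simp flip: power_mult_distrib)
  qed
  ultimately show ?thesis by simp
qed

text \<open>For \<open>N = 0\<close> the only node is \<open>0 / 0 = 0\<close>, still a point of
  \<open>[0, 1]\<close>, and the value is the constant \<open>m 0\<close>.\<close>

definition stieltjes_approx :: "(nat \<Rightarrow> real) \<Rightarrow> real \<Rightarrow> nat \<Rightarrow> complex \<Rightarrow> complex" where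
  "stieltjes_approx m \<sigma> N z = (\<Sum>k\<le>N. complex_of_real (hausdorff_weight m N k) *
     (1 - complex_of_real (real k / real N) * z) powr (- complex_of_real \<sigma>))"

lemma node_bounds: "k \<le> N \<Longrightarrow> 0 \<le> real k / real N \<and> real k / real N \<le> 1"
  by (cases "N = 0") auto

lemma stieltjes_approx_sums:
  assumes "norm z < 1"
  shows "(\<lambda>n. complex_of_real (pochhammer \<sigma> n / fact n) *
      complex_of_real (\<Sum>k\<le>N. hausdorff_weight m N k * (real k / real N) ^ n) * z ^ n)
    sums stieltjes_approx m \<sigma> N z"
proof -
  have "norm (complex_of_real (real k / real N) * z) < 1" if "k \<le> N" for k
  proof -
    have "norm (complex_of_real (real k / real N) * z) \<le> 1 * norm z"
      unfolding norm_mult norm_of_real using node_bounds[OF that] by (intro mult_right_mono) auto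
    with assms show ?thesis by simp
  qed
  then have "(\<lambda>n. \<Sum>k\<le>N. complex_of_real (hausdorff_weight m N k) *
      (complex_of_real (pochhammer \<sigma> n / fact n) * (complex_of_real (real k / real N) * z) ^ n))
    sums stieltjes_approx m \<sigma> N z"
    unfolding stieltjes_approx_def by (intro sums_sum sums_mult kernel_sums) auto
  moreover have "(\<Sum>k\<le>N. complex_of_real (hausdorff_weight m N k) *
      (complex_of_real (pochhammer \<sigma> n / fact n) * (complex_of_real (real k / real N) * z) ^ n))
    = complex_of_real (pochhammer \<sigma> n / fact n) *
      complex_of_real (\<Sum>k\<le>N. hausdorff_weight m N k * (real k / real N) ^ n) * z ^ n" for n
    unfolding of_real_sum sum_distrib_left sum_distrib_right
    by (intro sum.cong) (simp_all add: power_mult_distrib power_divide)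
  ultimately show ?thesis by simp
qed

text \<open>Tannery's theorem: the approximate moments lie in \<open>[0, m 0]\<close>, so the kernel
  series at \<open>norm z\<close>, scaled by \<open>m 0\<close>, dominates for every
  \<open>N\<close>.\<close>

lemma stieltjes_approx_tendsto:
  assumes m: "completely_monotone m" and "0 < \<sigma>" and z: "norm z < 1"
  shows "summable (\<lambda>n. complex_of_real (pochhammer \<sigma> n / fact n) * complex_of_real (m n) * z ^ n)"
    and "(\<lambda>N. stieltjes_approx m \<sigma> N z) \<longlonglongrightarrow>
    (\<Sum>n. complex_of_real (pochhammer \<sigma> n / fact n) * complex_of_real (m n) * z ^ n)"
proof -
  let ?c = "\<lambda>n. pochhammer \<sigma> n / fact n"
  let ?M = "\<lambda>N n. \<Sum>k\<le>N. hausdorff_weight m N k * (real k / real N) ^ n"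
  have M_bounds: "0 \<le> ?M N n \<and> ?M N n \<le> m 0" for N n
  proof
    show "0 \<le> ?M N n"
      using hausdorff_weight_nonneg[OF m] by (intro sum_nonneg) auto
    have "?M N n \<le> (\<Sum>k\<le>N. hausdorff_weight m N k * 1)"
      using hausdorff_weight_nonneg[OF m] node_bounds
      by (intro sum_mono mult_left_mono power_le_one) auto
    then show "?M N n \<le> m 0" by (simp add: sum_hausdorff_weight)
  qed
  have c_nonneg: "0 \<le> ?c n" for n using \<open>0 < \<sigma>\<close> by (simp add: pochhammer_nonneg)
  have "summable (\<lambda>n. complex_of_real (?c n) * complex_of_real (norm z) ^ n)"
    using kernel_sums[of "complex_of_real (norm z)" \<sigma>] z by (simp add: sums_iff)
  then have "summable (\<lambda>n. complex_of_real (?c n * norm z ^ n))" by simp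
  then have "summable (\<lambda>n. ?c n * norm z ^ n)" by (simp only: summable_complex_of_real)
  then have summable: "summable (\<lambda>n. m 0 * (?c n * norm z ^ n))" by (rule summable_mult)
  have "norm (complex_of_real (?c n) * complex_of_real (?M N n) * z ^ n) \<le> m 0 * (?c n * norm z ^ n)" for n N
  proof -
    have "norm (complex_of_real (?c n) * complex_of_real (?M N n) * z ^ n) = ?c n * norm z ^ n * ?M N n"
      using c_nonneg[of n] M_bounds[of N n] by (simp only: norm_mult norm_power norm_of_real abs_of_nonneg mult_ac)
    also have "\<dots> \<le> ?c n * norm z ^ n * m 0"
      using c_nonneg[of n] M_bounds[of N n] by (intro mult_left_mono mult_nonneg_nonneg) auto
    finally show ?thesis by (simp only: mult_ac)
  qed
  then have bound: "\<forall>\<^sub>F (n, N) in at_top \<times>\<^sub>F sequentially.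
      norm (complex_of_real (?c n) * complex_of_real (?M N n) * z ^ n) \<le> m 0 * (?c n * norm z ^ n)"
    by (intro always_eventually) auto
  have limit: "(\<lambda>N. complex_of_real (?c n) * complex_of_real (?M N n) * z ^ n) \<longlonglongrightarrow>
      complex_of_real (?c n) * complex_of_real (m n) * z ^ n" for n
    by (intro tendsto_mult tendsto_const tendsto_of_real hausdorff_moments_tendsto[OF m])
  have lim: "summable (\<lambda>n. norm (complex_of_real (?c n) * complex_of_real (m n) * z ^ n)) \<and>
      (\<lambda>N. \<Sum>n. complex_of_real (?c n) * complex_of_real (?M N n) * z ^ n) \<longlonglongrightarrow>
      (\<Sum>n. complex_of_real (?c n) * complex_of_real (m n) * z ^ n)"
    by (rule tannerys_theorem[OF limit bound summable sequentially_bot, THEN conjunct2])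
  show "summable (\<lambda>n. complex_of_real (?c n) * complex_of_real (m n) * z ^ n)"
    by (rule summable_norm_cancel[OF conjunct1[OF lim]])
  show "(\<lambda>N. stieltjes_approx m \<sigma> N z) \<longlonglongrightarrow>
      (\<Sum>n. complex_of_real (?c n) * complex_of_real (m n) * z ^ n)"
    using conjunct2[OF lim] unfolding sums_unique[OF stieltjes_approx_sums[OF z], symmetric] .
qed

lemma stieltjes_approx_holomorphic: "stieltjes_approx m \<sigma> N holomorphic_on slit_plane"
  unfolding stieltjes_approx_def
proof (intro holomorphic_intros)
  fix k z assume "k \<in> {..N}" "z \<in> slit_plane"
  then show "1 - complex_of_real (real k / real N) * z \<notin> \<real>\<^sub>\<le>\<^sub>0"
    using node_bounds[of k N] by (intro kernel_argument_not_nonpos) auto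
qed

text \<open>This is the local boundedness for Montel's theorem. The kernel is bounded on the compact
  set \<open>{0..1} \<times> K\<close>, and averaging multiplies the bound by the total mass
  \<open>m 0\<close>.\<close>

lemma stieltjes_approx_bounded:
  assumes m: "completely_monotone m" and K: "compact K" "K \<subseteq> slit_plane"
  shows "\<exists>B. \<forall>N. \<forall>z\<in>K. norm (stieltjes_approx m \<sigma> N z) \<le> B"
proof -
  let ?f = "\<lambda>p. (1 - complex_of_real (fst p) * snd p) powr (- complex_of_real \<sigma>)"
  have dom: "1 - complex_of_real (fst p) * snd p \<notin> \<real>\<^sub>\<le>\<^sub>0" if "p \<in> {0..1} \<times> K" for p
    using that K(2) by (intro kernel_argument_not_nonpos) auto
  then have "continuous_on ({0..1} \<times> K) (\<lambda>p. exp (- complex_of_real \<sigma> * Ln (1 - complex_of_real (fst p) * snd p)))"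
    by (intro continuous_intros) auto
  moreover have "?f p = exp (- complex_of_real \<sigma> * Ln (1 - complex_of_real (fst p) * snd p))"
    if "p \<in> {0..1} \<times> K" for p
    using dom[OF that] unfolding powr_def by (metis nonpos_Reals_zero_I)
  ultimately have "continuous_on ({0..1} \<times> K) ?f"
    by (simp cong: continuous_on_cong)
  then have "compact (?f ` ({0..1} \<times> K))"
    using K(1) by (intro compact_continuous_image compact_Times) auto
  then obtain C where C: "\<And>t z. t \<in> {0..1} \<Longrightarrow> z \<in> K \<Longrightarrow> norm (?f (t, z)) \<le> C"
    unfolding compact_eq_bounded_closed bounded_iff by blast
  have "norm (stieltjes_approx m \<sigma> N z) \<le> m 0 * C" if "z \<in> K" for N z
  proof -
    have "norm (stieltjes_approx m \<sigma> N z) \<le> (\<Sum>k\<le>N. hausdorff_weight m N k * C)"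
      unfolding stieltjes_approx_def
    proof (intro order.trans[OF norm_sum] sum_mono)
      fix k assume "k \<in> {..N}"
      then have "norm (?f (real k / real N, z)) \<le> C"
        using node_bounds[of k N] that by (intro C) auto
      then show "norm (complex_of_real (hausdorff_weight m N k) *
          (1 - complex_of_real (real k / real N) * z) powr (- complex_of_real \<sigma>)) \<le> hausdorff_weight m N k * C"
        unfolding norm_mult norm_of_real abs_of_nonneg[OF hausdorff_weight_nonneg[OF m]] fst_conv snd_conv
        by (rule mult_left_mono) (rule hausdorff_weight_nonneg[OF m])
    qed
    then show ?thesis by (simp only: sum_hausdorff_weight flip: sum_distrib_right)
  qed
  then show ?thesis by blast
qed

subsection \<open>The lower half-plane\<close>

text \<open>Adding 1 turns a point of the upper half-plane towards the positive axis. Both arguments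
  lie in \<open>(0, pi)\<close>, so the sine of their difference decides the order.\<close>

lemma Arg_one_plus_less:
  assumes "0 < Im w"
  shows "0 < Arg (1 + w)" "Arg (1 + w) < Arg w"
proof -
  have nz: "w \<noteq> 0" "1 + w \<noteq> 0" using assms by (auto simp: complex_eq_iff)
  have range: "0 < Arg w" "Arg w < pi" "0 < Arg (1 + w)" "Arg (1 + w) < pi"
    using assms Arg_lt_pi[of w] Arg_lt_pi[of "1 + w"] by simp_all
  \<comment> \<open>The numerator is \<open>Im (w * cnj (1 + w))\<close>, where the summand
    \<open>w * cnj w\<close> is real.\<close>
  have "sin (Arg w - Arg (1 + w)) = Im w / (norm w * norm (1 + w))"
    using nz by (simp add: sin_diff sin_Arg cos_Arg field_simps)
  also have "\<dots> > 0" using assms nz by simp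
  finally have pos: "0 < sin (Arg w - Arg (1 + w))" .
  show "Arg (1 + w) < Arg w"
  proof (rule ccontr)
    assume "\<not> Arg (1 + w) < Arg w"
    then have "0 \<le> sin (Arg (1 + w) - Arg w)"
      using range by (intro sin_ge_zero) auto
    with pos show False
      using sin_minus[of "Arg w - Arg (1 + w)"] by simp
  qed
  show "0 < Arg (1 + w)" by (rule range)
qed

lemma sector_Im_pos:
  assumes "0 < Arg z" "Arg z < pi / \<sigma>" "1 \<le> \<sigma>"
  shows "0 < Im z"
proof -
  have "pi / \<sigma> \<le> pi" using assms(3) by (simp add: divide_le_eq)
  then show ?thesis using assms Arg_lt_pi[of z] by linarith
qed

lemma uminus_sector_in_slit_plane:
  assumes "0 < Arg z" "Arg z < pi / \<sigma>" "1 \<le> \<sigma>"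
  shows "- z \<in> slit_plane"
proof -
  have "- z \<noteq> complex_of_real x" for x
    using sector_Im_pos[OF assms] by (auto simp: complex_eq_iff)
  then show ?thesis by (auto simp: slit_plane_def)
qed

text \<open>The argument of \<open>1 + t z\<close> lies between 0 and \<open>Arg z\<close>, so
  \<open>\<sigma>\<close> times it stays below \<open>pi\<close> and the negative exponent reflects
  it downwards. At \<open>t = 0\<close> the kernel is 1, hence only the weak inequality.\<close>

lemma Im_kernel_nonpos:
  assumes z: "0 < Arg z" "Arg z < pi / \<sigma>" and "1 \<le> \<sigma>" "0 \<le> t"
  shows "Im ((1 + complex_of_real t * z) powr (- complex_of_real \<sigma>)) \<le> 0"
proof (cases "t = 0")
  case False
  let ?w = "complex_of_real t * z"
  have "0 < Im z" using z \<open>1 \<le> \<sigma>\<close> by (rule sector_Im_pos)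
  then have w: "0 < Im ?w" using False \<open>0 \<le> t\<close> by simp
  have "Arg ?w = Arg z" using False \<open>0 \<le> t\<close> by (simp add: Arg_times_of_real)
  then have arg: "0 < Arg (1 + ?w)" "Arg (1 + ?w) < pi / \<sigma>"
    using Arg_one_plus_less[OF w] z by auto
  then have "0 \<le> sin (\<sigma> * Arg (1 + ?w))"
    using \<open>1 \<le> \<sigma>\<close> by (intro sin_ge_zero) (auto simp: field_simps)
  moreover have nz: "1 + ?w \<noteq> 0" using w by (auto simp: complex_eq_iff)
  ultimately show ?thesis
    by (simp add: powr_def Im_exp Arg_eq_Im_Ln[OF nz, symmetric])
qed simp

lemma open_sector:
  assumes "1 \<le> \<sigma>"
  shows "open {z. 0 < Arg z \<and> Arg z < pi / \<sigma>}"
proof -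
  \<comment> \<open>\<open>Arg\<close> is continuous only off the nonpositive reals, so the preimage
    is taken within the upper half-plane.\<close>
  have "{z. 0 < Arg z \<and> Arg z < pi / \<sigma>} = {z. 0 < Im z} \<inter> Arg -` {0<..<pi / \<sigma>}"
    using sector_Im_pos[OF _ _ assms] by auto
  moreover have "open ({z. 0 < Im z} \<inter> Arg -` {0<..<pi / \<sigma>})"
    by (intro continuous_open_preimage continuous_on_Arg' continuous_on_id)
      (auto simp: open_halfspace_Im_gt complex_nonpos_Reals_iff)
  ultimately show ?thesis by simp
qed

lemma open_subset_lower_half_plane:
  assumes "open W" "W \<subseteq> {w. Im w \<le> 0}"
  shows "W \<subseteq> {w. Im w < 0}"
  using interior_maximal[OF assms(2,1)] interior_halfspace_le[of \<i> 0]
  by (simp add: inner_complex_def)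

text \<open>Morally \<open>g\<close> is the integral of the kernel against the measure with moments
  \<open>m\<close>; positivity of \<open>m 1\<close> makes it nonconstant, which the open mapping
  theorem demands.\<close>

lemma stieltjes_continuation:
  assumes m: "completely_monotone m" and "0 < m 1" and \<sigma>: "1 \<le> \<sigma>"
  obtains g where "g holomorphic_on slit_plane"
    and "\<And>z. norm z < 1 \<Longrightarrow>
      (\<lambda>n. complex_of_real (pochhammer \<sigma> n / fact n) * complex_of_real (m n) * z ^ n) sums g z"
    and "\<And>z. 0 < Arg z \<Longrightarrow> Arg z < pi / \<sigma> \<Longrightarrow> Im (g (- z)) < 0"
proof -
  let ?a = "\<lambda>n. complex_of_real (pochhammer \<sigma> n / fact n) * complex_of_real (m n)"
  obtain g and r :: "nat \<Rightarrow> nat" where g: "g holomorphic_on slit_plane" and r: "strict_mono r"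
    and lim: "\<And>z. z \<in> slit_plane \<Longrightarrow> (\<lambda>n. stieltjes_approx m \<sigma> (r n) z) \<longlonglongrightarrow> g z"
  proof (rule Montel[of slit_plane "range (stieltjes_approx m \<sigma>)" "stieltjes_approx m \<sigma>"])
    show "\<exists>B. \<forall>h\<in>range (stieltjes_approx m \<sigma>). \<forall>z\<in>K. norm (h z) \<le> B"
      if "compact K" "K \<subseteq> slit_plane" for K
      using stieltjes_approx_bounded[OF m that] by auto
  qed (auto simp: open_slit_plane stieltjes_approx_holomorphic)
  have sums: "(\<lambda>n. ?a n * z ^ n) sums g z" if z: "norm z < 1" for z
  proof -
    have "z \<in> slit_plane" using z ball_subset_slit_plane by auto
    \<comment> \<open>On the unit disc the whole sequence converges to the series, so the Montel
      subsequence has that limit too.\<close>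
    have "(\<lambda>n. stieltjes_approx m \<sigma> (r n) z) \<longlonglongrightarrow> (\<Sum>n. ?a n * z ^ n)"
      using LIMSEQ_subseq_LIMSEQ[OF stieltjes_approx_tendsto(2)[OF m _ z, of \<sigma>] r] \<sigma>
      by (simp add: o_def)
    then have "g z = (\<Sum>n. ?a n * z ^ n)"
      using lim[OF \<open>z \<in> slit_plane\<close>] LIMSEQ_unique by blast
    then show ?thesis
      using stieltjes_approx_tendsto(1)[OF m _ z, of \<sigma>] \<sigma> by (simp add: summable_sums)
  qed
  have nonconst: "\<not> g constant_on slit_plane"
  proof
    assume "g constant_on slit_plane"
    then obtain c where c: "\<And>z. z \<in> slit_plane \<Longrightarrow> g z = c"
      unfolding constant_on_def by blast
    \<comment> \<open>Subtracting \<open>g 0\<close> gives a zero at the origin; the coefficient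
      \<open>\<sigma> * m 1\<close> is nonzero, so this zero is isolated, contradicting
      constancy.\<close>
    define h where "h z = g z - g 0" for z
    have h: "h z = 0" if "norm z < 1" for z
    proof -
      have "z \<in> slit_plane" "0 \<in> slit_plane" using that ball_subset_slit_plane by auto
      then show ?thesis by (simp add: h_def c)
    qed
    have h_sums: "(\<lambda>n. (if n = 0 then ?a 0 - g 0 else ?a n) * (z - 0) ^ n) sums h z" if "norm (z - 0) < 1" for z
    proof -
      have "(\<lambda>n. if n = 0 then g 0 else 0) sums g 0"
        by (rule sums_single)
      then have "(\<lambda>n. ?a n * z ^ n - (if n = 0 then g 0 else 0)) sums (g z - g 0)"
        using that by (intro sums_diff sums) simp_all
      moreover have "(\<lambda>n. ?a n * z ^ n - (if n = 0 then g 0 else 0)) =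
          (\<lambda>n. (if n = 0 then ?a 0 - g 0 else ?a n) * (z - 0) ^ n)"
        by (intro ext) simp
      ultimately show ?thesis by (simp only: h_def)
    qed
    have "h 0 = 0" "?a 1 \<noteq> 0"
      using \<open>0 < m 1\<close> \<sigma> by (simp_all add: h)
    then obtain s where s: "0 < s" "\<And>z. z \<in> cball 0 s - {0} \<Longrightarrow> h z \<noteq> 0"
      using powser_0_nonzero[where r = 1 and \<xi> = 0 and f = h and m = 1
          and a = "\<lambda>n. if n = 0 then ?a 0 - g 0 else ?a n", OF zero_less_one h_sums]
      by (metis zero_less_one zero_neq_one)
    define x where "x = complex_of_real (min s (1/2))"
    have "x \<in> cball 0 s - {0}" "norm x < 1" using s(1) by (auto simp: x_def)
    then show False using s(2) h by blast
  qed
  let ?S = "{z. 0 < Arg z \<and> Arg z < pi / \<sigma>}"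
  have sub: "uminus ` ?S \<subseteq> slit_plane"
    using uminus_sector_in_slit_plane[OF _ _ \<sigma>] by auto
  have "open (g ` uminus ` ?S)"
    by (rule open_mapping_thm[OF g open_slit_plane connected_slit_plane
      open_negations[OF open_sector[OF \<sigma>]] sub nonconst])
  moreover have "Im (g (- z)) \<le> 0" if z: "0 < Arg z" "Arg z < pi / \<sigma>" for z
  proof -
    have "- z \<in> slit_plane" using z \<sigma> by (rule uminus_sector_in_slit_plane)
    have "Im (stieltjes_approx m \<sigma> N (- z)) \<le> 0" for N
      unfolding stieltjes_approx_def Im_sum
    proof (rule sum_nonpos)
      fix k assume "k \<in> {..N}"
      have "Im ((1 + complex_of_real (real k / real N) * z) powr (- complex_of_real \<sigma>)) \<le> 0"
        by (rule Im_kernel_nonpos[OF z \<sigma>]) simp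
      then show "Im (complex_of_real (hausdorff_weight m N k) *
          (1 - complex_of_real (real k / real N) * - z) powr (- complex_of_real \<sigma>)) \<le> 0"
        using hausdorff_weight_nonneg[OF m, of N k] by (simp add: mult_nonneg_nonpos)
    qed
    then show ?thesis
      using tendsto_Im[OF lim[OF \<open>- z \<in> slit_plane\<close>]] by (intro LIMSEQ_le_const2) auto
  qed
  then have "g ` uminus ` ?S \<subseteq> {w. Im w \<le> 0}" by auto
  ultimately have "g ` uminus ` ?S \<subseteq> {w. Im w < 0}"
    by (rule open_subset_lower_half_plane)
  then have "Im (g (- z)) < 0" if "0 < Arg z" "Arg z < pi / \<sigma>" for z
    using that by blast
  then show ?thesis using that[OF g sums] by blast
qed

section \<open>Identification with the hypergeometric function\<close>

lemma foldl_mult_eq_prod_list: "foldl (\<lambda>r a. r * f a) c xs = c * prod_list (map f xs)"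
  for c :: "'a::comm_monoid_mult"
  by (induction xs arbitrary: c) (simp_all add: mult_ac)

lemma fps_hypergeo_of_real_nth:
  assumes "length A = q" "length B = q"
  shows "fps_hypergeo (map complex_of_real (\<sigma> # A)) (map complex_of_real B) 1 $ n =
    complex_of_real (pochhammer \<sigma> n / fact n) * complex_of_real (poch_ratio q ((!) A) ((!) B) n)"
proof -
  have "prod_list (map (\<lambda>x. pochhammer x n) (map complex_of_real xs)) =
      complex_of_real (\<Prod>i<length xs. pochhammer (xs ! i) n)" for xs
    by (simp add: prod.list_conv_set_nth pochhammer_of_real atLeast0LessThan)
  then show ?thesis
    using assms
    by (simp add: foldl_mult_eq_prod_list poch_ratio_def prod_dividef pochhammer_of_real del: map_map)
qed

text \<open>The given \<open>f\<close> shows that the choice in \<open>hypergeo\<close> has a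
  witness; uniqueness of continuation then identifies the two.\<close>

lemma hypergeo_eq_continuation:
  assumes "f holomorphic_on slit_plane"
    and "\<And>z. norm z < 1 \<Longrightarrow> f z = eval_fps (fps_hypergeo as bs 1) z" and "z \<in> slit_plane"
  shows "hypergeo as bs z = f z"
proof -
  let ?P = "\<lambda>f. f holomorphic_on slit_plane \<and>
      (\<forall>z. norm z < 1 \<longrightarrow> f z = eval_fps (fps_hypergeo as bs 1) z)"
  have "?P f" using assms(1,2) by blast
  then have "?P (hypergeo as bs)" unfolding hypergeo_def by (rule someI[of ?P])
  then have hol: "hypergeo as bs holomorphic_on slit_plane"
    and eq: "\<And>z. norm z < 1 \<Longrightarrow> hypergeo as bs z = eval_fps (fps_hypergeo as bs 1) z"
    by blast+
  show ?thesis
    by (rule hypergeo_continuation_unique[OF hol assms(1) _ assms(3)]) (simp only: eq assms(2))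
qed

theorem theorem12:
  fixes q :: nat and A B :: "real list" and \<sigma> :: real
  assumes "1 \<le> q" and "length A = q" and "length B = q"
    and "weak_supermaj B A" and "1 \<le> \<sigma>"
  shows "(\<lambda>z. hypergeo (map complex_of_real (\<sigma> # A)) (map complex_of_real B) (- z)) `
           {z. 0 < Arg z \<and> Arg z < pi / \<sigma>} \<subseteq> {w. Im w < 0}"
proof -
  let ?m = "poch_ratio q ((!) A) ((!) B)"
  have maj: "\<forall>a\<in>set A. 0 < a" "\<forall>b\<in>set B. 0 < b" "sorted B"
    "\<forall>k\<in>{1..q}. (\<Sum>i<k. A ! i) \<le> (\<Sum>i<k. B ! i)"
    using assms(4) unfolding weak_supermaj_def assms(2) by - (elim conjE, assumption)+
  have pos: "0 < A ! i" "0 < B ! i" if "i < q" for i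
    using maj(1,2) that assms(2,3) by simp_all
  have "completely_monotone ?m"
  proof (rule completely_monotone_poch_ratio)
    show "B ! i \<le> B ! Suc i" if "Suc i < q" for i
      using that assms(3) by (intro sorted_nth_mono[OF maj(3)]) simp_all
    show "(\<Sum>i<k. A ! i) \<le> (\<Sum>i<k. B ! i)" if "k \<le> q" for k
    \<comment> \<open>The majorization hypothesis starts at \<open>k = 1\<close>; for
      \<open>k = 0\<close> both sums are empty.\<close>
    proof (cases "k = 0")
      case False
      then show ?thesis using that maj(4) by simp
    qed simp
  qed (use pos in simp_all)
  moreover have "0 < ?m 1"
    unfolding poch_ratio_def using pos by (intro prod_pos) simp
  ultimately obtain g where g: "g holomorphic_on slit_plane"
    and sums: "\<And>z. norm z < 1 \<Longrightarrow>
      (\<lambda>n. complex_of_real (pochhammer \<sigma> n / fact n) * complex_of_real (?m n) * z ^ n) sums g z"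
    and Im: "\<And>z. 0 < Arg z \<Longrightarrow> Arg z < pi / \<sigma> \<Longrightarrow> Im (g (- z)) < 0"
    by (rule stieltjes_continuation[OF _ _ assms(5)]) (rule that)
  have eq: "hypergeo (map complex_of_real (\<sigma> # A)) (map complex_of_real B) z = g z"
    if "z \<in> slit_plane" for z
  proof (rule hypergeo_eq_continuation[OF g _ that])
    show "g z = eval_fps (fps_hypergeo (map complex_of_real (\<sigma> # A)) (map complex_of_real B) 1) z"
      if "norm z < 1" for z
      unfolding eval_fps_def fps_hypergeo_of_real_nth[OF assms(2,3)]
      by (rule sums_unique[OF sums[OF that]])
  qed
  show ?thesis
  proof (rule image_subsetI, unfold mem_Collect_eq, elim conjE)
    fix z assume z: "0 < Arg z" "Arg z < pi / \<sigma>"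
    show "Im (hypergeo (map complex_of_real (\<sigma> # A)) (map complex_of_real B) (- z)) < 0"
      unfolding eq[OF uminus_sector_in_slit_plane[OF z assms(5)]] using z by (rule Im)
  qed
qed

end
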